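(* Let $d\in\mathbb{N}$ be odd, let $\chi$ be a Dirichlet character with conductor $d$, let $r\in\mathbb{N}$, let $q\in\mathbb{C}$ with $0<|q|<1$, and let $a,b\in\mathbb{N}$ with $a\equiv 1\pmod 2$ and $b\equiv 1\pmod 2$. Then for every integer $n\ge 0$ and every real $x$, \[ [2]_{q^b}^r\,[a]_q^n\sum_{j_1,\dots,j_r=0}^{da-1}(-1)^{\sum_{l=1}^r j_l}\Big(\prod_{l=1}^r\chi(j_l)\Big)q^{b\sum_{l=1}^r j_l}\,E^{(r)}_{n,\chi,q^a}\Big(bx+\frac{b}{a}\sum_{l=1}^r j_l\Big) \] \[ =[2]_{q^a}^r\,[b]_q^n\sum_{j_1,\dots,j_r=0}^{db-1}(-1)^{\sum_{l=1}^r j_l}\Big(\prod_{l=1}^r\chi(j_l)\Big)q^{a\sum_{l=1}^r j_l}\,E^{(r)}_{n,\chi,q^b}\Big(ax+\frac{a}{b}\sum_{l=1}^r j_l\Big). \]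
   Context: Fix a value of $\log q$ and, for real $y$ and $c\in\mathbb{N}$, set $(q^c)^y=e^{cy\log q}$. For $p=q^c$ ($c\in\mathbb{N}$) and real $y$, $[y]_p=\frac{1-p^y}{1-p}$, and $[2]_p^r$ is the $r$-th power of $[2]_p$. The generalized higher-order $q$-Euler polynomials $E^{(r)}_{n,\chi,p}(y)$ attached to $\chi$ are defined by the generating function \[ [2]_p^r\sum_{m_1,\dots,m_r=0}^{\infty}(-p)^{m_1+\cdots+m_r}\Big(\prod_{i=1}^r\chi(m_i)\Big)e^{[m_1+\cdots+m_r+y]_p\,t}=\sum_{n=0}^{\infty}E^{(r)}_{n,\chi,p}(y)\frac{t^n}{n!}, \] where $\chi(m)$ is the value of the Dirichlet character at the integer $m$. *)

theory Defs
  imports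
    "HOL-Complex_Analysis.Complex_Analysis"
    "HOL-Number_Theory.Cong"
begin

definition dirichlet_character :: "nat \<Rightarrow> (int \<Rightarrow> complex) \<Rightarrow> bool" where
  "dirichlet_character d chi \<longleftrightarrow>
     d > 0 \<and>
     (\<forall>m. chi (m + int d) = chi m) \<and>
     (\<forall>m n. chi (m * n) = chi m * chi n) \<and>
     (\<forall>m. chi m \<noteq> 0 \<longleftrightarrow> coprime m (int d))"

text \<open>
  The conductor of a character \<open>chi\<close> modulo \<open>d\<close> is the least divisor \<open>f\<close> of \<open>d\<close> such that \<open>chi\<close>
  factors through the units modulo \<open>f\<close>. The character is primitive if and only if its conductor
  is \<open>d\<close> itself.
\<close>

definition conductor :: "nat \<Rightarrow> (int \<Rightarrow> complex) \<Rightarrow> nat" where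
  "conductor d chi =
     (LEAST f. f dvd d \<and> (\<forall>m. coprime m (int d) \<and> [m = 1] (mod int f) \<longrightarrow> chi m = 1))"

text \<open>
  Real powers of \<open>q\<^sup>c\<close> depend on the chosen value \<open>lq\<close> of \<open>log q\<close> and on the exponent \<open>c\<close>,
  not only on the complex number \<open>q\<^sup>c\<close>. A base \<open>p = q\<^sup>c\<close> is therefore represented by the
  pair \<open>lq\<close>, \<open>c\<close> in all of the following definitions, and \<open>p\<close> itself is \<open>q_power lq c 1\<close>.
\<close>

definition q_power :: "complex \<Rightarrow> nat \<Rightarrow> real \<Rightarrow> complex" where
  "q_power lq c y = exp (of_nat c * of_real y * lq)"

definition q_number :: "complex \<Rightarrow> nat \<Rightarrow> real \<Rightarrow> complex" where
  "q_number lq c y = (1 - q_power lq c y) / (1 - q_power lq c 1)"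

definition q_euler_gf ::
  "nat \<Rightarrow> (int \<Rightarrow> complex) \<Rightarrow> complex \<Rightarrow> nat \<Rightarrow> real \<Rightarrow> complex \<Rightarrow> complex" where
  "q_euler_gf r chi lq c y t =
     q_number lq c 2 ^ r *
     (\<Sum>\<^sub>\<infinity>m\<in>{1..r} \<rightarrow>\<^sub>E (UNIV :: nat set).
        (- q_power lq c 1) ^ (\<Sum>i=1..r. m i) * (\<Prod>i=1..r. chi (int (m i))) *
        exp (q_number lq c (real (\<Sum>i=1..r. m i) + y) * t))"

text \<open>
  The coefficient of \<open>t\<^sup>n / n!\<close> in the generating function; the lemma \<open>q_euler_gf_sums\<close> below
  justifies reading it as such.
\<close>

definition q_euler ::
  "nat \<Rightarrow> (int \<Rightarrow> complex) \<Rightarrow> complex \<Rightarrow> nat \<Rightarrow> nat \<Rightarrow> real \<Rightarrow> complex" where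
  "q_euler r chi lq c n y = (deriv ^^ n) (q_euler_gf r chi lq c y) 0"

lemma q_power_of_nat: "q_power lq c (real k) = (exp lq ^ c) ^ k"
  by (simp add: q_power_def exp_of_nat_mult [symmetric] power_mult [symmetric] mult_ac)

lemma q_power_1: "q_power lq c 1 = exp lq ^ c"
  using q_power_of_nat [of lq c 1] by simp

lemma q_power_add: "q_power lq c (x + y) = q_power lq c x * q_power lq c y"
  by (simp add: q_power_def exp_add [symmetric] algebra_simps)

lemma dirichlet_character_norm_le:
  assumes "dirichlet_character d chi"
  shows "norm (chi m) \<le> 1"
proof (cases "coprime m (int d)")
  case True
  have per: "chi (a + int d * int k) = chi a" for a k
  proof (induction k)
    case (Suc k)
    have "chi (a + int d * int (Suc k)) = chi ((a + int d * int k) + int d)"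
      by (simp add: algebra_simps)
    also have "\<dots> = chi (a + int d * int k)"
      using assms unfolding dirichlet_character_def by blast
    finally show ?case using Suc by simp
  qed simp
  have mult: "chi (a * b) = chi a * chi b" for a b
    using assms unfolding dirichlet_character_def by blast
  have d: "d > 0" using assms unfolding dirichlet_character_def by blast
  have red: "chi a = chi (a mod int d)" for a
  proof -
    have *: "x = y" if "int d dvd x - y" "x \<ge> y" "chi x \<noteq> chi y" for x y
    proof -
      from that obtain k where k: "x - y = int d * k" by blast
      with that d have "k \<ge> 0"
        by (metis diff_ge_0_iff_ge of_nat_0_less_iff zero_le_mult_iff not_less)
      then have "x = y + int d * int (nat k)" using k by simp
      then show ?thesis using per [of y "nat k"] that by simp
    qed
    have "a = int d * (a div int d) + a mod int d" by simp
    then have "int d dvd a - a mod int d" by (metis add_diff_cancel_right' dvd_triv_left)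
    then show ?thesis
      using * [of a "a mod int d"] * [of "a mod int d" a]
      by (metis dvd_minus_iff minus_diff_eq linorder_le_cases)
  qed
  have pow: "chi (m ^ k) = chi m ^ k" if "k > 0" for k
    using that by (induction k rule: nat_induct_non_zero) (auto simp: mult)
  have "bounded (range chi)"
  proof -
    have "range chi \<subseteq> chi ` {0..<int d}"
    proof
      fix z assume "z \<in> range chi"
      then obtain a where "z = chi a" by blast
      then have "z = chi (a mod int d)" using red by blast
      moreover have "a mod int d \<in> {0..<int d}" using d by simp
      ultimately show "z \<in> chi ` {0..<int d}" by blast
    qed
    then show ?thesis
      by (meson bounded_subset finite_imageI finite_imp_bounded finite_atLeastLessThan_int)
  qed
  then obtain B where B: "\<And>a. norm (chi a) \<le> B" unfolding bounded_iff by auto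
  show ?thesis
  proof (rule ccontr)
    assume "\<not> norm (chi m) \<le> 1"
    then obtain k where "B < norm (chi m) ^ k"
      using real_arch_pow [of "norm (chi m)" B] by auto
    moreover have "norm (chi m) ^ k \<le> norm (chi m) ^ Suc k"
      using \<open>\<not> norm (chi m) \<le> 1\<close> by (intro power_increasing) auto
    moreover have "norm (chi m) ^ Suc k = norm (chi (m ^ Suc k))"
      using pow [of "Suc k"] norm_power by (metis zero_less_Suc)
    ultimately show False using B [of "m ^ Suc k"] by linarith
  qed
next
  case False
  then show ?thesis using assms unfolding dirichlet_character_def by auto
qed

lemma infsum_exp_sums:
  fixes c z :: "'a \<Rightarrow> complex"
  assumes c: "(\<lambda>m. norm (c m)) summable_on A" and B: "\<And>m. m \<in> A \<Longrightarrow> norm (z m) \<le> B"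
  shows "(\<lambda>n. (\<Sum>\<^sub>\<infinity>m\<in>A. c m * z m ^ n) / fact n * t ^ n) sums (\<Sum>\<^sub>\<infinity>m\<in>A. c m * exp (z m * t))"
proof -
  define f where "f = (\<lambda>m n. c m * ((z m * t) ^ n /\<^sub>R fact n))"
  have ns: "((\<lambda>n. norm (f m n)) has_sum (norm (c m) * exp (norm (z m * t)))) UNIV" for m
  proof -
    have "(\<lambda>n. norm (z m * t) ^ n /\<^sub>R fact n) sums exp (norm (z m * t))"
      by (rule exp_converges)
    then have "(\<lambda>n. norm (c m) * (norm (z m * t) ^ n /\<^sub>R fact n)) sums
                 (norm (c m) * exp (norm (z m * t)))"
      by (rule sums_mult)
    then have "(\<lambda>n. norm (f m n)) sums (norm (c m) * exp (norm (z m * t)))"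
      by (simp add: f_def norm_mult norm_power divide_inverse mult_ac)
    then show ?thesis
      by (intro norm_summable_imp_has_sum) (auto simp: sums_iff)
  qed
  have s: "(f m has_sum (c m * exp (z m * t))) UNIV" for m
  proof (rule norm_summable_imp_has_sum)
    show "summable (\<lambda>n. norm (f m n))"
      using ns [of m] has_sum_imp_sums sums_summable by blast
    show "f m sums (c m * exp (z m * t))"
      unfolding f_def by (intro sums_mult exp_converges)
  qed
  have "(\<lambda>m. norm (c m) * exp (norm (z m * t))) summable_on A"
  proof (rule summable_on_comparison_test)
    show "(\<lambda>m. norm (c m) * exp (B * norm t)) summable_on A"
      using c by (rule summable_on_cmult_left)
    show "norm (c m) * exp (norm (z m * t)) \<le> norm (c m) * exp (B * norm t)" if "m \<in> A" for m
      using B [OF that] by (intro mult_left_mono) (auto simp: norm_mult intro: mult_right_mono)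
  qed auto
  then have "(\<lambda>(m, n). norm (f m n)) summable_on A \<times> UNIV"
    using ns by (intro summable_on_SigmaI) auto
  then have sum: "(\<lambda>(m, n). f m n) summable_on A \<times> UNIV"
    by - (rule abs_summable_summable, simp add: case_prod_unfold)
  have "((\<lambda>(m, n). f m n) has_sum (\<Sum>\<^sub>\<infinity>(m, n)\<in>A \<times> UNIV. f m n)) (A \<times> UNIV)"
    using sum by (rule has_sum_infsum)
  moreover have "(\<Sum>\<^sub>\<infinity>(m, n)\<in>A \<times> UNIV. f m n) = (\<Sum>\<^sub>\<infinity>m\<in>A. c m * exp (z m * t))"
    using infsum_Sigma'_banach [OF sum] by (simp add: infsumI [OF s])
  ultimately have "((\<lambda>(n, m). f m n) has_sum (\<Sum>\<^sub>\<infinity>m\<in>A. c m * exp (z m * t))) (UNIV \<times> A)"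
    by (subst (asm) has_sum_swap) simp
  moreover have "((\<lambda>m. f m n) has_sum (\<Sum>\<^sub>\<infinity>m\<in>A. f m n)) A" for n
  proof (rule has_sum_infsum)
    have "(\<lambda>(n, m). f m n) summable_on UNIV \<times> A"
      using sum by (subst (asm) summable_on_swap) simp
    then show "(\<lambda>m. f m n) summable_on A"
      by (rule summable_on_SigmaD1) auto
  qed
  ultimately have "((\<lambda>n. \<Sum>\<^sub>\<infinity>m\<in>A. f m n) has_sum (\<Sum>\<^sub>\<infinity>m\<in>A. c m * exp (z m * t))) UNIV"
    using has_sum_SigmaD [where f = "\<lambda>(n, m). f m n" and A = UNIV and B = "\<lambda>_. A"
      and g = "\<lambda>n. \<Sum>\<^sub>\<infinity>m\<in>A. f m n"] by auto
  moreover have "(\<Sum>\<^sub>\<infinity>m\<in>A. f m n) = (\<Sum>\<^sub>\<infinity>m\<in>A. c m * z m ^ n) / fact n * t ^ n" for n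
  proof -
    have "(\<Sum>\<^sub>\<infinity>m\<in>A. f m n) = (\<Sum>\<^sub>\<infinity>m\<in>A. (c m * z m ^ n) * (t ^ n / fact n))"
      by (simp add: f_def power_mult_distrib scaleR_conv_of_real field_simps)
    also have "\<dots> = (\<Sum>\<^sub>\<infinity>m\<in>A. c m * z m ^ n) * (t ^ n / fact n)"
      by (rule infsum_cmult_left')
    finally show ?thesis by simp
  qed
  ultimately show ?thesis by (simp add: has_sum_imp_sums)
qed

lemma higher_deriv_sums:
  fixes a :: "nat \<Rightarrow> complex"
  assumes "\<And>t. (\<lambda>n. a n / fact n * t ^ n) sums f t"
  shows "(deriv ^^ n) f 0 = a n"
proof -
  define F where "F = Abs_fps (\<lambda>n. a n / fact n)"
  have "eval_fps F t = f t" for t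
    using assms [of t] by (simp add: eval_fps_def F_def sums_iff)
  moreover have "fps_conv_radius F \<ge> 1"
    unfolding fps_conv_radius_def F_def using conv_radius_geI [of "\<lambda>n. a n / fact n" 1] assms [of 1]
    by (simp add: one_ereal_def sums_iff)
  ultimately have "f has_fps_expansion F"
    unfolding has_fps_expansion_def by (auto intro: less_le_trans [of 0 1])
  then have "fps_nth F n = (deriv ^^ n) f 0 / fact n"
    by (rule fps_nth_fps_expansion)
  then show ?thesis by (simp add: F_def)
qed

lemma q_euler_gf_coeff_sums:
  assumes chi: "dirichlet_character d chi" and lq: "norm (exp lq) < 1" and c: "c > 0"
  shows "(\<lambda>n. (q_number lq c 2 ^ r *
           (\<Sum>\<^sub>\<infinity>m\<in>{1..r} \<rightarrow>\<^sub>E (UNIV :: nat set).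
              (- q_power lq c 1) ^ (\<Sum>i=1..r. m i) * (\<Prod>i=1..r. chi (int (m i))) *
              q_number lq c (real (\<Sum>i=1..r. m i) + y) ^ n)) / fact n * t ^ n)
         sums q_euler_gf r chi lq c y t"
proof -
  define p where "p = q_power lq c 1"
  have p: "norm p < 1"
    using lq c by (simp add: p_def q_power_1 norm_power power_less_one_iff)
  define w where "w = (\<lambda>m :: nat \<Rightarrow> nat. (- p) ^ (\<Sum>i=1..r. m i) * (\<Prod>i=1..r. chi (int (m i))))"
  define z where "z = (\<lambda>m :: nat \<Rightarrow> nat. q_number lq c (real (\<Sum>i=1..r. m i) + y))"
  have w: "(\<lambda>m. norm (w m)) summable_on ({1..r} \<rightarrow>\<^sub>E UNIV)"
  proof -
    have "summable (\<lambda>k. norm ((- p) ^ k * chi (int k)))"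
    proof (rule summable_comparison_test')
      show "summable (\<lambda>k. norm p ^ k)" using p by (simp add: summable_geometric)
      show "norm (norm ((- p) ^ k * chi (int k))) \<le> norm p ^ k" for k
        using dirichlet_character_norm_le [OF chi, of "int k"]
        by (simp add: norm_mult norm_power mult_left_le)
    qed
    then have "Infinite_Set_Sum.abs_summable_on (\<lambda>k. (- p) ^ k * chi (int k)) UNIV"
      by (simp add: abs_summable_on_nat_iff')
    then have "Infinite_Set_Sum.abs_summable_on
                 (\<lambda>m. \<Prod>i\<in>{1..r}. (- p) ^ m i * chi (int (m i))) ({1..r} \<rightarrow>\<^sub>E UNIV)"
      by (intro abs_summable_on_prod_PiE) auto
    then show ?thesis
      by (simp add: w_def prod.distrib power_sum abs_summable_equivalent [symmetric])
  qed
  have z: "norm (z m) \<le> (1 + norm (q_power lq c y)) / norm (1 - p)" for m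
  proof -
    have "norm (1 - p ^ k * q_power lq c y) \<le> 1 + norm (q_power lq c y)" for k
    proof -
      have "norm (1 - p ^ k * q_power lq c y) \<le> 1 + norm (p ^ k * q_power lq c y)"
        by (metis norm_one norm_triangle_ineq4)
      also have "norm (p ^ k * q_power lq c y) \<le> 1 * norm (q_power lq c y)"
        unfolding norm_mult norm_power using p by (intro mult_right_mono power_le_one) auto
      finally show ?thesis by simp
    qed
    moreover have "q_power lq c (real k + y) = p ^ k * q_power lq c y" for k
      by (simp only: q_power_add q_power_of_nat p_def q_power_1)
    ultimately show ?thesis
      by (simp add: z_def q_number_def norm_divide p_def [symmetric] divide_right_mono
               del: of_nat_sum)
  qed
  from sums_mult [OF infsum_exp_sums [OF w z, where t = t], of "q_number lq c 2 ^ r"]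
  show ?thesis by (simp add: q_euler_gf_def w_def z_def p_def mult.assoc)
qed

lemma q_euler_gf_sums:
  assumes "dirichlet_character d chi" and "norm (exp lq) < 1" and "c > 0"
  shows "(\<lambda>n. q_euler r chi lq c n y * t ^ n / fact n) sums q_euler_gf r chi lq c y t"
  using q_euler_gf_coeff_sums [OF assms, of r y t]
  by (simp add: q_euler_def higher_deriv_sums [OF q_euler_gf_coeff_sums [OF assms]])

end

theory Submission
  imports Defs
begin

text \<open>
  Inserting the series of the \<open>q\<close>-Euler polynomials turns the left-hand side into
  \<open>[2]\<^sub>p\<^sup>r [2]\<^sub>p\<^sub>'\<^sup>r\<close>, with \<open>p = q\<^sup>a\<close> and \<open>p' = q\<^sup>b\<close>, times a sum over pairs \<open>(j, m)\<close> with
  \<open>0 \<le> j\<^sub>l < da\<close> and \<open>m\<^sub>l \<ge> 0\<close>. The summand is the product of the weights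
  \<open>(-1)\<^bsup>j\<^sub>l + m\<^sub>l\<^esup> \<chi>(j\<^sub>l) \<chi>(m\<^sub>l)\<close> and a function of \<open>\<Sum>\<^sub>l (b j\<^sub>l + a m\<^sub>l)\<close>. Writing \<open>m\<^sub>l = i\<^sub>l + d b k\<^sub>l\<close>
  with \<open>0 \<le> i\<^sub>l < db\<close>, one has \<open>b j\<^sub>l + a m\<^sub>l = a i\<^sub>l + b (j\<^sub>l + d a k\<^sub>l)\<close>, and the weights at
  \<open>(j\<^sub>l, m\<^sub>l)\<close> and \<open>(i\<^sub>l, j\<^sub>l + d a k\<^sub>l)\<close> agree because \<open>da\<close> and \<open>db\<close> are odd multiples of \<open>d\<close>.
  So \<open>(j, m) \<mapsto> (i, j + d a k)\<close> carries the sum to the same one with \<open>a\<close> and \<open>b\<close> exchanged.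
\<close>

lemma dirichlet_character_cong:
  assumes "dirichlet_character d chi" "[m = n] (mod d)"
  shows "chi (int m) = chi (int n)"
proof -
  have per: "chi (int u + int d * int k) = chi (int u)" for u k
  proof (induction k)
    case (Suc k)
    have "chi (int u + int d * int (Suc k)) = chi ((int u + int d * int k) + int d)"
      by (simp add: algebra_simps)
    also have "\<dots> = chi (int u + int d * int k)"
      using assms unfolding dirichlet_character_def by blast
    finally show ?case using Suc by simp
  qed simp
  have "chi (int u) = chi (int (u mod d))" for u
    using per [of "u mod d" "u div d"] by (simp flip: of_nat_mult of_nat_add)
  then show ?thesis
    using assms(2) by (metis cong_def)
qed

text \<open>The coefficient series of the generating function converges for every \<open>t\<close>,
  so the \<open>n\<close>-th derivative at 0 reads off its \<open>n\<close>-th coefficient. This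
  turns the polynomial into an explicit infinite sum.\<close>

lemma q_euler_eq_infsum:
  assumes "dirichlet_character d chi" and "norm (exp lq) < 1" and "c > 0"
  shows "q_euler r chi lq c n y = q_number lq c 2 ^ r *
           (\<Sum>\<^sub>\<infinity>m\<in>{1..r} \<rightarrow>\<^sub>E (UNIV :: nat set).
              (- q_power lq c 1) ^ (\<Sum>i=1..r. m i) * (\<Prod>i=1..r. chi (int (m i))) *
              q_number lq c (real (\<Sum>i=1..r. m i) + y) ^ n)"
  unfolding q_euler_def by (rule higher_deriv_sums [OF q_euler_gf_coeff_sums [OF assms]])

text \<open>With p = q^c of norm below 1, the weights are dominated by a product of \<open>r\<close>
  geometric series, and the powers p^k have norm at most 1, so the q-numbers are bounded uniformly
  in \<open>m\<close>. This permits merging a finite sum over \<open>j\<close> with the series over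
  \<open>m\<close>.\<close>

lemma q_euler_terms_summable:
  fixes r c n :: nat
  assumes chi: "dirichlet_character d chi" and lq: "norm (exp lq) < 1" and c: "c > 0"
  shows "(\<lambda>m. (- q_power lq c 1) ^ (\<Sum>i=1..r. m i) * (\<Prod>i=1..r. chi (int (m i))) *
              q_number lq c (real (\<Sum>i=1..r. m i) + y) ^ n)
           summable_on {1..r} \<rightarrow>\<^sub>E (UNIV :: nat set)"
proof -
  define p where "p = q_power lq c 1"
  have p: "norm p < 1"
    using lq c by (simp add: p_def q_power_1 norm_power power_less_one_iff)
  define w where "w = (\<lambda>m :: nat \<Rightarrow> nat. (- p) ^ (\<Sum>i=1..r. m i) * (\<Prod>i=1..r. chi (int (m i))))"
  define B where "B = (1 + norm (q_power lq c y)) / norm (1 - p)"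
  have "summable (\<lambda>k. norm ((- p) ^ k * chi (int k)))"
  proof (rule summable_comparison_test')
    show "summable (\<lambda>k. norm p ^ k)" using p by (simp add: summable_geometric)
    show "norm (norm ((- p) ^ k * chi (int k))) \<le> norm p ^ k" for k
      using dirichlet_character_norm_le [OF chi, of "int k"]
      by (simp add: norm_mult norm_power mult_left_le)
  qed
  then have "Infinite_Set_Sum.abs_summable_on
               (\<lambda>m. \<Prod>i\<in>{1..r}. (- p) ^ m i * chi (int (m i))) ({1..r} \<rightarrow>\<^sub>E UNIV)"
    by (intro abs_summable_on_prod_PiE) (auto simp: abs_summable_on_nat_iff')
  then have w: "(\<lambda>m. norm (w m)) summable_on ({1..r} \<rightarrow>\<^sub>E UNIV)"
    by (simp add: w_def prod.distrib power_sum abs_summable_equivalent [symmetric])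
  have q_number_le: "norm (q_number lq c (real k + y)) \<le> B" for k
  proof -
    have "norm (1 - p ^ k * q_power lq c y) \<le> 1 + norm p ^ k * norm (q_power lq c y)"
      using norm_triangle_ineq4 [of 1 "p ^ k * q_power lq c y"] by (simp add: norm_mult norm_power)
    also have "\<dots> \<le> 1 + norm (q_power lq c y)"
      using p by (simp add: mult_left_le_one_le power_le_one)
    finally show ?thesis
      unfolding q_number_def B_def norm_divide q_power_add q_power_of_nat p_def q_power_1
      by (rule divide_right_mono) simp
  qed
  have "(\<lambda>m. norm (w m) * B ^ n) summable_on {1..r} \<rightarrow>\<^sub>E UNIV"
    using w by (rule summable_on_cmult_left)
  then have "(\<lambda>m. norm (w m * q_number lq c (real (\<Sum>i=1..r. m i) + y) ^ n))
               summable_on {1..r} \<rightarrow>\<^sub>E UNIV"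
  proof (rule Infinite_Sum.abs_summable_on_comparison_test')
    show "norm (w m * q_number lq c (real (\<Sum>i=1..r. m i) + y) ^ n) \<le> norm (w m) * B ^ n" for m
      unfolding norm_mult norm_power by (intro mult_left_mono power_mono q_number_le) auto
  qed
  then show ?thesis
    unfolding w_def p_def by (rule abs_summable_summable)
qed

text \<open>The product is a finite disjoint union of slices, so summability on each slice
  suffices.\<close>

lemma sum_infsum_Times:
  fixes f :: "'a \<Rightarrow> 'b \<Rightarrow> complex"
  assumes "finite A" and "\<And>x. x \<in> A \<Longrightarrow> f x summable_on B"
  shows "(\<Sum>x\<in>A. infsum (f x) B) = (\<Sum>\<^sub>\<infinity>(x, y)\<in>A \<times> B. f x y)"
proof -
  have inj: "inj_on (Pair x) B" for x :: 'a
    by (simp add: inj_on_def)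
  have "(\<Sum>x\<in>A. infsum (f x) B) = (\<Sum>x\<in>A. infsum (\<lambda>(x, y). f x y) (Pair x ` B))"
    by (simp add: infsum_reindex [OF inj] o_def)
  also have "\<dots> = infsum (\<lambda>(x, y). f x y) (\<Union>x\<in>A. Pair x ` B)"
    using assms by (intro sum_infsum) (auto simp: summable_on_reindex [OF inj] o_def)
  also have "(\<Union>x\<in>A. Pair x ` B) = A \<times> B"
    by auto
  finally show ?thesis .
qed

text \<open>With \<open>m l\<close> = i + \<open>N\<close> * k and i < \<open>N\<close>, the triple
  (\<open>j l\<close>, i, k) is regrouped: k moves from the pair with i to the pair with
  \<open>j l\<close>. Restriction to \<open>I\<close> keeps the results extensional.\<close>

definition mixed_digits ::
  "'i set \<Rightarrow> nat \<Rightarrow> nat \<Rightarrow> ('i \<Rightarrow> nat) \<times> ('i \<Rightarrow> nat) \<Rightarrow> ('i \<Rightarrow> nat) \<times> ('i \<Rightarrow> nat)" where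
  "mixed_digits I M N = (\<lambda>(j, m). (\<lambda>l\<in>I. m l mod N, \<lambda>l\<in>I. j l + M * (m l div N)))"

lemma mixed_digits_in:
  assumes "N > 0"
  shows "mixed_digits I M N v \<in> (I \<rightarrow>\<^sub>E {..<N}) \<times> (I \<rightarrow>\<^sub>E UNIV)"
  using assms by (auto simp: mixed_digits_def split: prod.splits)

text \<open>As \<open>j l < M\<close>, division of \<open>j l + M * k\<close> by \<open>M\<close>
  recovers \<open>j l\<close> as remainder and \<open>k\<close> as quotient, so exchanging the
  moduli reverses the regrouping.\<close>

lemma mixed_digits_inverse:
  assumes "v \<in> (I \<rightarrow>\<^sub>E {..<M}) \<times> (I \<rightarrow>\<^sub>E UNIV)"
  shows "mixed_digits I N M (mixed_digits I M N v) = v"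
proof -
  obtain j m where v: "v = (j, m)" by fastforce
  have lt: "j l < M" if "l \<in> I" for l
    using assms that by (auto simp: v)
  have div: "(j l + M * k) div M = k" if "l \<in> I" for l k
    using lt [OF that] by (simp add: div_mult_self2)
  have j: "(\<lambda>l\<in>I. (j l + M * (m l div N)) mod M) = j"
    using assms lt by (intro extensionalityI [of _ I]) (auto simp: v PiE_def)
  have m: "(\<lambda>l\<in>I. m l mod N + N * ((j l + M * (m l div N)) div M)) = m"
    using assms by (intro extensionalityI [of _ I]) (auto simp: v PiE_def div)
  show ?thesis
    using j m by (simp add: v mixed_digits_def cong: restrict_cong)
qed

text \<open>Only signs and character values are kept explicit; powers of q and q-numbers go into the
  arbitrary function \<open>h\<close>. Reindexing along a bijection preserves \<open>infsum\<close>,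
  so convergence plays no part here.\<close>

lemma infsum_character_swap:
  fixes h :: "nat \<Rightarrow> complex"
  assumes chi: "dirichlet_character d chi" and odd: "odd d" "odd a" "odd b"
    and fin: "finite I"
  defines "W \<equiv> \<lambda>u. \<Prod>l\<in>I. (-1) ^ u l * chi (int (u l))"
  shows "(\<Sum>\<^sub>\<infinity>(j, m)\<in>(I \<rightarrow>\<^sub>E {..<d * a}) \<times> (I \<rightarrow>\<^sub>E UNIV). W j * W m * h (b * sum j I + a * sum m I)) =
         (\<Sum>\<^sub>\<infinity>(j, m)\<in>(I \<rightarrow>\<^sub>E {..<d * b}) \<times> (I \<rightarrow>\<^sub>E UNIV). W j * W m * h (a * sum j I + b * sum m I))"
proof (rule infsum_reindex_bij_witness
    [where i = "mixed_digits I (d * b) (d * a)" and j = "mixed_digits I (d * a) (d * b)"])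
  define g where "g = (\<lambda>k. (-1) ^ k * chi (int k))"
  have pos: "d * a > 0" "d * b > 0"
    using odd by (auto intro!: Nat.gr0I)
  fix v assume v: "v \<in> (I \<rightarrow>\<^sub>E {..<d * a}) \<times> (I \<rightarrow>\<^sub>E (UNIV :: nat set))"
  obtain j m where jm: "v = (j, m)" by fastforce
  define i where "i = (\<lambda>l\<in>I. m l mod (d * b))"
  define k where "k = (\<lambda>l\<in>I. j l + d * a * (m l div (d * b)))"
  have "g (j l) * g (m l) = g (i l) * g (k l)" if "l \<in> I" for l
  proof -
    have "chi (int (m l)) = chi (int (i l))"
      using that by (intro dirichlet_character_cong [OF chi]) (simp add: i_def cong_def mod_mult2_eq)
    moreover have "chi (int (j l)) = chi (int (k l))"
      using that by (intro dirichlet_character_cong [OF chi]) (simp add: k_def cong_def mult.assoc)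
    \<comment> \<open>Unlike the character values, the signs agree only jointly: if the quotient
      \<open>m l div (d * b)\<close> is odd, both \<open>m l\<close> and \<open>j l\<close> change
      parity, as \<open>d * a\<close> and \<open>d * b\<close> are odd.\<close>
    moreover have "even (j l + m l) \<longleftrightarrow> even (i l + k l)"
    proof -
      have "even (m l) \<longleftrightarrow> (even (m l mod (d * b)) \<longleftrightarrow> even (m l div (d * b)))"
        using odd by (metis even_add even_mult_iff mod_mult_div_eq)
      then show ?thesis
        using odd that by (auto simp: i_def k_def)
    qed
    then have "(-1 :: complex) ^ (j l + m l) = (-1) ^ (i l + k l)"
      by (simp add: uminus_power_if)
    ultimately show ?thesis
      by (simp add: g_def power_add mult_ac)
  qed
  then have "W j * W m = W i * W k"
    unfolding W_def g_def by (simp flip: prod.distrib)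
  moreover have "b * sum j I + a * sum m I = a * sum i I + b * sum k I"
  proof -
    \<comment> \<open>Both sides equal
      \<open>b * j l + a * i l + a * b * d * (m l div (d * b))\<close>.\<close>
    have "b * j l + a * m l = a * i l + b * k l" if "l \<in> I" for l
    proof -
      have "a * m l = a * (m l mod (d * b) + d * b * (m l div (d * b)))"
        by simp
      then show ?thesis
        using that by (simp add: i_def k_def algebra_simps del: mod_mult_div_eq)
    qed
    then show ?thesis
      by (simp add: sum_distrib_left flip: sum.distrib)
  qed
  ultimately show "(case mixed_digits I (d * a) (d * b) v of
      (j, m) \<Rightarrow> W j * W m * h (a * sum j I + b * sum m I)) =
    (case v of (j, m) \<Rightarrow> W j * W m * h (b * sum j I + a * sum m I))"
    by (simp add: jm mixed_digits_def i_def k_def)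
  show "mixed_digits I (d * b) (d * a) (mixed_digits I (d * a) (d * b) v) = v"
    using v by (rule mixed_digits_inverse)
  show "mixed_digits I (d * a) (d * b) v \<in> (I \<rightarrow>\<^sub>E {..<d * b}) \<times> (I \<rightarrow>\<^sub>E UNIV)"
    using pos by (intro mixed_digits_in)
next
  fix v assume v: "v \<in> (I \<rightarrow>\<^sub>E {..<d * b}) \<times> (I \<rightarrow>\<^sub>E (UNIV :: nat set))"
  have pos: "d * a > 0"
    using odd by (auto intro!: Nat.gr0I)
  show "mixed_digits I (d * a) (d * b) (mixed_digits I (d * b) (d * a) v) = v"
    using v by (rule mixed_digits_inverse)
  show "mixed_digits I (d * b) (d * a) v \<in> (I \<rightarrow>\<^sub>E {..<d * a}) \<times> (I \<rightarrow>\<^sub>E UNIV)"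
    using pos by (intro mixed_digits_in)
qed

text \<open>The identity \<open>[a]_q [z]_(q^a) = [a z]_q\<close> brings all q-numbers to base q,
  and q^(b J) (q^a)^M = q^(b J + a M) for the digit sums J and M. Each term thus depends on these
  only through b J + a M, by a function \<open>h\<close> symmetric in \<open>a\<close> and
  \<open>b\<close>.\<close>

lemma q_euler_sum_eq_infsum:
  fixes d r a b n :: nat and x :: real
  assumes chi: "dirichlet_character d chi" and lq: "norm (exp lq) < 1" and odd: "odd d" "odd a"
  defines "W \<equiv> \<lambda>u. \<Prod>l=1..r. (-1) ^ u l * chi (int (u l))"
    and "h \<equiv> \<lambda>s. exp lq ^ s * q_number lq 1 (real s + real a * real b * x) ^ n"
  shows "q_number lq 1 (real a) ^ n *
       (\<Sum>j\<in>{1..r} \<rightarrow>\<^sub>E {0..d * a - 1}.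
          (-1) ^ (\<Sum>l=1..r. j l) * (\<Prod>l=1..r. chi (int (j l))) * exp lq ^ (b * (\<Sum>l=1..r. j l)) *
          q_euler r chi lq a n (real b * x + real b / real a * real (\<Sum>l=1..r. j l))) =
     q_number lq a 2 ^ r *
       (\<Sum>\<^sub>\<infinity>(j, m)\<in>({1..r} \<rightarrow>\<^sub>E {..<d * a}) \<times> ({1..r} \<rightarrow>\<^sub>E UNIV).
          W j * W m * h (b * sum j {1..r} + a * sum m {1..r}))"
proof -
  have a: "a > 0" and da: "d * a > 0"
    using odd by (auto intro!: Nat.gr0I)
  \<comment> \<open>Natural subtraction truncates: for \<open>d * a = 0\<close> the left side would
    be \<open>{0}\<close> and the right side empty.\<close>
  have range: "{0..d * a - 1} = {..<d * a}"
    using da by (metis Suc_pred' atLeast0AtMost lessThan_Suc_atMost)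
  have W: "W u = (-1) ^ (\<Sum>l=1..r. u l) * (\<Prod>l=1..r. chi (int (u l)))" for u
    by (simp add: W_def prod.distrib power_sum)
  define y where "y = (\<lambda>j. real b * x + real b / real a * real (\<Sum>l=1..r. j l))"
  define t where "t = (\<lambda>j m. (- q_power lq a 1) ^ (\<Sum>l=1..r. m l) *
    (\<Prod>l=1..r. chi (int (m l))) * q_number lq a (real (\<Sum>l=1..r. m l) + y j) ^ n)"
  define e where "e = (\<lambda>j. q_number lq 1 (real a) ^ n * (W j * exp lq ^ (b * (\<Sum>l=1..r. j l))))"
  have sm: "t j summable_on {1..r} \<rightarrow>\<^sub>E UNIV" for j
    unfolding t_def by (rule q_euler_terms_summable [OF chi lq a])
  \<comment> \<open>This allows cancelling 1 - q^a, the numerator of \<open>[a]_q\<close> and the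
    denominator of q-numbers in base q^a.\<close>
  have "norm (exp lq ^ a) < 1"
    using lq a by (simp add: norm_power power_less_one_iff)
  then have ne: "1 - exp lq ^ a \<noteq> 0"
    by (metis eq_iff_diff_eq_0 norm_one less_irrefl)
  have key: "e j * t j m = W j * W m * h (b * sum j {1..r} + a * sum m {1..r})" for j m
  proof -
    define s where "s = b * sum j {1..r} + a * sum m {1..r}"
    have "real a * (real (sum m {1..r}) + y j) = real s + real a * real b * x"
      using a by (simp add: y_def s_def distrib_left del: of_nat_sum)
    moreover have "q_power lq a z = q_power lq 1 (real a * z)" for z
      by (simp add: q_power_def)
    ultimately have "q_power lq a (real (sum m {1..r}) + y j) =
        q_power lq 1 (real s + real a * real b * x)"
      by (simp only:)
    moreover have "q_power lq 1 (real a) = exp lq ^ a"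
      by (simp add: q_power_of_nat)
    ultimately have "q_number lq 1 (real a) * q_number lq a (real (sum m {1..r}) + y j) =
        q_number lq 1 (real s + real a * real b * x)"
      using ne by (simp add: q_number_def q_power_1 del: of_nat_sum)
    then have num: "q_number lq 1 (real a) ^ n * q_number lq a (real (sum m {1..r}) + y j) ^ n =
        q_number lq 1 (real s + real a * real b * x) ^ n"
      by (simp flip: power_mult_distrib)
    have pow: "(- q_power lq a 1) ^ sum m {1..r} * exp lq ^ (b * sum j {1..r}) =
        (-1) ^ sum m {1..r} * exp lq ^ s"
      by (subst power_minus) (simp add: q_power_1 s_def power_add power_mult mult_ac)
    have arrange: "u * (v * z) * (p * c * w) = v * c * (p * z) * (u * w)" for u v z p c w :: complex
      by (simp only: mult_ac)
    show ?thesis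
      unfolding e_def t_def h_def W [of m] s_def [symmetric]
      by (rule trans [OF arrange]) (unfold num pow, simp only: mult_ac)
  qed
  have "q_number lq 1 (real a) ^ n *
       (\<Sum>j\<in>{1..r} \<rightarrow>\<^sub>E {0..d * a - 1}.
          (-1) ^ (\<Sum>l=1..r. j l) * (\<Prod>l=1..r. chi (int (j l))) * exp lq ^ (b * (\<Sum>l=1..r. j l)) *
          q_euler r chi lq a n (y j)) =
     q_number lq a 2 ^ r * (\<Sum>j\<in>{1..r} \<rightarrow>\<^sub>E {0..d * a - 1}. e j * infsum (t j) ({1..r} \<rightarrow>\<^sub>E UNIV))"
    unfolding q_euler_eq_infsum [OF chi lq a] e_def t_def W sum_distrib_left
    by (intro sum.cong refl) (simp only: mult_ac)
  also have "(\<Sum>j\<in>{1..r} \<rightarrow>\<^sub>E {0..d * a - 1}. e j * infsum (t j) ({1..r} \<rightarrow>\<^sub>E UNIV)) =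
      (\<Sum>j\<in>{1..r} \<rightarrow>\<^sub>E {0..d * a - 1}. \<Sum>\<^sub>\<infinity>m\<in>{1..r} \<rightarrow>\<^sub>E UNIV. e j * t j m)"
    by (simp add: infsum_cmult_right')
  also have "\<dots> = (\<Sum>\<^sub>\<infinity>(j, m)\<in>({1..r} \<rightarrow>\<^sub>E {0..d * a - 1}) \<times> ({1..r} \<rightarrow>\<^sub>E UNIV). e j * t j m)"
    by (intro sum_infsum_Times summable_on_cmult_right sm finite_PiE) auto
  finally show ?thesis
    by (simp only: key y_def range)
qed

theorem theorem2:
  fixes d r a b n :: nat and chi :: "int \<Rightarrow> complex" and q lq :: complex and x :: real
  assumes "odd d"
    and "dirichlet_character d chi" and "conductor d chi = d"
    and "r \<ge> 1"
    and "0 < norm q" and "norm q < 1" and "exp lq = q"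
    and "[a = 1] (mod 2)" and "[b = 1] (mod 2)"
  shows
    "q_number lq b 2 ^ r * q_number lq 1 (real a) ^ n *
       (\<Sum>j\<in>{1..r} \<rightarrow>\<^sub>E {0..d * a - 1}.
          (-1) ^ (\<Sum>l=1..r. j l) * (\<Prod>l=1..r. chi (int (j l))) * q ^ (b * (\<Sum>l=1..r. j l)) *
          q_euler r chi lq a n (real b * x + real b / real a * real (\<Sum>l=1..r. j l)))
     = q_number lq a 2 ^ r * q_number lq 1 (real b) ^ n *
       (\<Sum>j\<in>{1..r} \<rightarrow>\<^sub>E {0..d * b - 1}.
          (-1) ^ (\<Sum>l=1..r. j l) * (\<Prod>l=1..r. chi (int (j l))) * q ^ (a * (\<Sum>l=1..r. j l)) *
          q_euler r chi lq b n (real a * x + real a / real b * real (\<Sum>l=1..r. j l)))"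
proof -
  have lq: "norm (exp lq) < 1" and q: "q = exp lq" and odd: "odd a" "odd b"
    using assms by (auto simp: cong_def odd_iff_mod_2_eq_one)
  define h where "h = (\<lambda>s. exp lq ^ s * q_number lq 1 (real s + real a * real b * x) ^ n)"
  show ?thesis
    \<comment> \<open>Each expansion supplies the power of \<open>[2]\<close> missing on its side;
      \<open>mult.commute\<close> aligns the shifts \<open>real a * real b * x\<close> inside
      \<open>h\<close>. After the swap, only the order of the two leading factors differs.\<close>
    unfolding q mult.assoc [of "q_number lq a 2 ^ r"] mult.assoc [of "q_number lq b 2 ^ r"]
      q_euler_sum_eq_infsum [OF assms(2) lq \<open>odd d\<close> odd(1)]
      q_euler_sum_eq_infsum [OF assms(2) lq \<open>odd d\<close> odd(2)]
      mult.commute [of "real b" "real a"]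
      infsum_character_swap [OF assms(2) \<open>odd d\<close> odd finite_atLeastAtMost,
        where h = h, unfolded h_def]
    by (rule mult.left_commute)
qed

end
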